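(* Let $X$ be a partially ordered normed space with ordering cone $\mathcal{C}$, let $\mathcal{Q}\subset X$ be an open cone, and let $x_0\in A\subset X$. Assume that $x_0$ is a $\mathcal{Q}$-minimal point of $A$ and that $\mathcal{C}\cap\mathcal{Q}\neq\emptyset$. If $(\mathcal{C},\mathcal{Q}_0)$ has the strict separation property (SSP), then there exists $(f,\alpha)\in\mathcal{C}^{a\#}_+$ such that $$\min_{x\in A}\ f(x-x_0)+\alpha\|x-x_0\|$$ is attained only at $x_0$.
   Context: $X$ is a real normed space with origin $0_X$, dual $X^*$ and unit sphere $S_X=\{x\in X:\|x\|=1\}$. For $S\subset X$: $\overline S$ is the closure, $\mathrm{bd}(S)$ the boundary, $\mathrm{co}(S)$ the convex hull, and $S_0:=S\cup\{0_X\}$. A cone is a set $\mathcal{C}\subset X$ with $\lambda x\in\mathcal{C}$ for all $\lambda\ge0$, $x\in\mathcal{C}$; all cones are assumed non-trivial: $\{0_X\}\subsetneq\mathcal{C}\subsetneq X$. A partially ordered normed space with ordering cone $\mathcal{C}$ is a normed space $X$ together with a (non-trivial) convex cone $\mathcal{C}$ that is pointed, i.e. $(-\mathcal{C})\cap\mathcal{C}=\{0_X\}$ (ordered by $x\le y\Leftrightarrow y-x\in\mathcal{C}$). An open cone is an open set $\mathcal{Q}\subset X$ such that $\mathcal{Q}_0$ is a (non-trivial) cone. A point $x_0\in A$ is a $\mathcal{Q}$-minimal point of $A$ if $(A-x_0)\cap(-\mathcal{Q})=\emptyset$. For a cone $\mathcal{C}$, $\mathcal{C}_{\wedge}:=\mathrm{co}(\mathcal{C}\cap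 S_X)$ and $\mathcal{C}_{\vee}:=\mathrm{co}((\mathrm{bd}(\mathcal{C})\cap S_X)_0)$. The pair of cones $(\mathcal{C},\mathcal{K})$ has the strict separation property (SSP) if $0_X\notin\overline{\mathcal{C}_{\wedge}-\mathcal{K}_{\vee}}$ (Minkowski difference). $\mathcal{C}^{\#}:=\{f\in X^*: f(x)>0\ \forall x\in\mathcal{C},\ x\neq0_X\}$ and $\mathcal{C}^{a\#}_+:=\{(f,\alpha)\in\mathcal{C}^{\#}\times(0,\infty): f(x)-\alpha\|x\|>0\ \forall x\in\mathcal{C},\ x\neq0_X\}$. *)

theory Defs
  imports "HOL-Analysis.Analysis"
begin

definition nontrivial_cone :: "'a::real_normed_vector set \<Rightarrow> bool" where
  "nontrivial_cone C \<longleftrightarrow> cone C \<and> {0} \<subset> C \<and> C \<subset> UNIV"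

definition ordering_cone :: "'a::real_normed_vector set \<Rightarrow> bool" where
  "ordering_cone C \<longleftrightarrow> nontrivial_cone C \<and> convex C \<and> uminus ` C \<inter> C = {0}"

text \<open>The origin is adjoined because an open cone \<open>Q\<close> does not contain it: an open set
  around the origin that is a cone would be the whole space.\<close>

definition open_cone :: "'a::real_normed_vector set \<Rightarrow> bool" where
  "open_cone Q \<longleftrightarrow> open Q \<and> nontrivial_cone (insert 0 Q)"

definition minimal_point :: "'a::real_normed_vector set \<Rightarrow> 'a set \<Rightarrow> 'a \<Rightarrow> bool" where
  "minimal_point Q A x0 \<longleftrightarrow> x0 \<in> A \<and> (\<lambda>a. a - x0) ` A \<inter> uminus ` Q = {}"

definition cone_wedge :: "'a::real_normed_vector set \<Rightarrow> 'a set" where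
  "cone_wedge C = convex hull (C \<inter> sphere 0 1)"

definition cone_vee :: "'a::real_normed_vector set \<Rightarrow> 'a set" where
  "cone_vee C = convex hull (insert 0 (frontier C \<inter> sphere 0 1))"

text \<open>The difference of the two sets is the Minkowski difference; the operation \<open>-\<close> on
  type \<open>set\<close> would be the set-theoretic one.\<close>

definition strict_separation_property ::
    "'a::real_normed_vector set \<Rightarrow> 'a set \<Rightarrow> bool" where
  "strict_separation_property C K \<longleftrightarrow>
     0 \<notin> closure {c - k | c k. c \<in> cone_wedge C \<and> k \<in> cone_vee K}"

definition dual_sharp :: "'a::real_normed_vector set \<Rightarrow> ('a \<Rightarrow>\<^sub>L real) set" where
  "dual_sharp C = {f. \<forall>x\<in>C. x \<noteq> 0 \<longrightarrow> blinfun_apply f x > 0}"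

definition augmented_dual_sharp ::
    "'a::real_normed_vector set \<Rightarrow> (('a \<Rightarrow>\<^sub>L real) \<times> real) set" where
  "augmented_dual_sharp C =
     {(f, \<alpha>). f \<in> dual_sharp C \<and> \<alpha> > 0 \<and>
        (\<forall>x\<in>C. x \<noteq> 0 \<longrightarrow> blinfun_apply f x - \<alpha> * norm x > 0)}"

end

theory Submission
  imports Defs
begin

text \<open>
  The strict separation property says that the convex set \<open>C\<^sub>\<and> - K\<^sub>\<or>\<close>, with \<open>K\<close> the cone
  \<open>Q\<close> with the origin adjoined, keeps a positive distance from the origin. By Hahn--Banach there are
  a functional \<open>f\<close> and a level \<open>\<alpha> > 0\<close> with \<open>f > \<alpha>\<close> on \<open>C \<inter> S\<^sub>X\<close> and \<open>f < \<alpha>\<close> on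
  \<open>frontier K \<inter> S\<^sub>X\<close>. The Bishop--Phelps cone \<open>{z. f z \<ge> \<alpha> \<parallel>z\<parallel>}\<close> without the origin is
  convex, hence connected, misses the frontier of \<open>K\<close>, and meets \<open>Q\<close> because \<open>C\<close> does; so it lies in
  \<open>Q\<close>, and \<open>Q\<close>-minimality makes \<open>f (x - x\<^sub>0) + \<alpha> \<parallel>x - x\<^sub>0\<parallel>\<close> positive for
  \<open>x \<in> A\<close>, \<open>x \<noteq> x\<^sub>0\<close>.

  Hahn--Banach is obtained from the fact that minimal sublinear functionals are linear.
\<close>

section \<open>Sublinear functionals and their lowering\<close>

definition sublinear :: "('a::real_vector \<Rightarrow> real) \<Rightarrow> bool" where
  "sublinear p \<longleftrightarrow> (\<forall>x y. p (x + y) \<le> p x + p y) \<and> (\<forall>c x. c \<ge> 0 \<longrightarrow> p (c *\<^sub>R x) = c * p x)"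

lemma sublinear_add: "sublinear p \<Longrightarrow> p (x + y) \<le> p x + p y"
  and sublinear_scaleR: "sublinear p \<Longrightarrow> c \<ge> 0 \<Longrightarrow> p (c *\<^sub>R x) = c * p x"
  by (auto simp: sublinear_def)

lemma sublinear_zero: "sublinear p \<Longrightarrow> p 0 = 0"
  using sublinear_scaleR[of p 0 0] by simp

lemma sublinear_diff: "sublinear p \<Longrightarrow> p x - p (- y) \<le> p (x + y)"
  using sublinear_add[of p "x + y" "- y"] by simp

text \<open>An inequality for positive \<open>c\<close> suffices: applied to \<open>1 / c\<close>
  and \<open>c *\<^sub>R x\<close> it gives the reverse one. This suits functionals defined as
  infima.\<close>

lemma sublinearI:
  fixes p :: "'a::real_vector \<Rightarrow> real"
  assumes add: "\<And>x y. p (x + y) \<le> p x + p y"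
    and zero: "p 0 = 0"
    and scale: "\<And>c x. c > 0 \<Longrightarrow> p (c *\<^sub>R x) \<le> c * p x"
  shows "sublinear p"
proof -
  have "p (c *\<^sub>R x) = c * p x" if "c > 0" for c x
  proof -
    have "p x \<le> (1 / c) * p (c *\<^sub>R x)"
      using scale[of "1 / c" "c *\<^sub>R x"] that by simp
    then show ?thesis
      using scale[OF that, of x] that by (simp add: field_simps)
  qed
  then have "p (c *\<^sub>R x) = c * p x" if "c \<ge> 0" for c x
    using that zero by (cases "c = 0") auto
  then show ?thesis
    using add by (auto simp: sublinear_def)
qed

lemma sublinear_norm: "sublinear (norm :: 'a::real_normed_vector \<Rightarrow> real)"
  by (simp add: sublinear_def norm_triangle_ineq)

text \<open>The witness is \<open>q x = inf {p (x + g) - r | (g, r) \<in> G}\<close>. With \<open>G\<close> the ray through \<open>(y, p y)\<close>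
  it forces a minimal \<open>p\<close> to be odd at \<open>y\<close>; with \<open>p = norm\<close> and \<open>G\<close> the cone over \<open>S \<times> {\<delta>}\<close>
  it yields the majorant that separates \<open>S\<close> from the origin.\<close>

lemma sublinear_improve:
  fixes p :: "'a::real_vector \<Rightarrow> real" and G :: "('a \<times> real) set"
  assumes p: "sublinear p"
    and zero: "0 \<in> G"
    and add: "\<And>u v. u \<in> G \<Longrightarrow> v \<in> G \<Longrightarrow> u + v \<in> G"
    and scale: "\<And>c u. c > 0 \<Longrightarrow> u \<in> G \<Longrightarrow> c *\<^sub>R u \<in> G"
    and le: "\<And>g r. (g, r) \<in> G \<Longrightarrow> r \<le> p g"
  obtains q where "sublinear q" "q \<le> p" "\<And>g r. (g, r) \<in> G \<Longrightarrow> q (- g) \<le> - r"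
proof -
  define h where "h = (\<lambda>x u. p (x + fst u) - snd u)"
  define q where "q = (\<lambda>x. INF u\<in>G. h x u)"
  \<comment> \<open>This bound does not depend on \<open>u\<close>, so the real-valued
    \<open>INF\<close> defining \<open>q\<close> is a true infimum.\<close>
  have lower: "- p (- x) \<le> h x u" if "u \<in> G" for x u
    using le[of "fst u" "snd u"] sublinear_diff[OF p, of "fst u" x] that
    by (simp add: h_def add.commute)
  have q_le: "q x \<le> h x u" if "u \<in> G" for x u
    unfolding q_def using lower that by (intro cINF_lower bdd_belowI2[of _ "- p (- x)"])
  have q_ge: "a \<le> q x" if "\<And>u. u \<in> G \<Longrightarrow> a \<le> h x u" for a x
    unfolding q_def using zero that by (intro cINF_greatest) auto
  have q_p: "q x \<le> p x" for x
    using q_le[OF zero, of x] by (simp add: h_def)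
  have "sublinear q"
  proof (rule sublinearI)
    fix x y
    have *: "q (x + y) \<le> h x u + h y v" if "u \<in> G" "v \<in> G" for u v
    proof -
      have "q (x + y) \<le> h (x + y) (u + v)"
        using q_le add that by blast
      also have "\<dots> \<le> h x u + h y v"
        using sublinear_add[OF p, of "x + fst u" "y + fst v"] by (simp add: h_def algebra_simps)
      finally show ?thesis .
    qed
    \<comment> \<open>The two infima are taken in turn: over the second element of \<open>G\<close>
      with \<open>u\<close> fixed, then over \<open>u\<close>.\<close>
    have "q (x + y) - h x u \<le> q y" if "u \<in> G" for u
      using *[OF that] by (intro q_ge) (simp add: algebra_simps)
    then have "q (x + y) - q y \<le> q x"
      by (intro q_ge) (simp add: algebra_simps)
    then show "q (x + y) \<le> q x + q y" by simp
  next
    have "0 \<le> q 0"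
      using lower[of _ 0] by (intro q_ge) (simp add: sublinear_zero[OF p])
    then show "q 0 = 0"
      using q_p[of 0] sublinear_zero[OF p] by simp
  next
    fix c :: real and x
    assume c: "c > 0"
    have "q (c *\<^sub>R x) / c \<le> q x"
    proof (rule q_ge)
      fix u assume u: "u \<in> G"
      have "q (c *\<^sub>R x) \<le> h (c *\<^sub>R x) (c *\<^sub>R u)"
        using q_le scale[OF c u] by blast
      also have "\<dots> = c * h x u"
        using sublinear_scaleR[OF p, of c "x + fst u"] c
        by (simp add: h_def algebra_simps)
      finally show "q (c *\<^sub>R x) / c \<le> h x u"
        using c by (simp add: field_simps)
    qed
    then show "q (c *\<^sub>R x) \<le> c * q x"
      using c by (simp add: field_simps)
  qed
  moreover have "q (- g) \<le> - r" if "(g, r) \<in> G" for g r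
    using q_le[OF that, of "- g"] by (simp add: h_def sublinear_zero[OF p])
  ultimately show thesis
    using that q_p by (simp add: le_fun_def)
qed

text \<open>Lowering \<open>p\<close> along the ray through \<open>(y, p y)\<close> cannot change
  it, which gives \<open>p (- y) \<le> - p y\<close>; subadditivity gives the converse. Once
  \<open>p\<close> is odd, subadditivity and \<open>sublinear_diff\<close> combine to
  additivity.\<close>

lemma minimal_sublinear_linear:
  fixes p :: "'a::real_vector \<Rightarrow> real"
  assumes p: "sublinear p"
    and minimal: "\<And>q. sublinear q \<Longrightarrow> q \<le> p \<Longrightarrow> q = p"
  shows "linear p"
proof -
  have neg: "p (- y) = - p y" for y
  proof -
    define G where "G = (\<lambda>t. (t *\<^sub>R y, t * p y)) ` {0..}"
    obtain q where q: "sublinear q" "q \<le> p" "\<And>g r. (g, r) \<in> G \<Longrightarrow> q (- g) \<le> - r"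
    proof (rule sublinear_improve[OF p, of G])
      show "0 \<in> G"
        unfolding G_def by (intro image_eqI[of _ _ 0]) (auto simp: zero_prod_def)
      show "u + v \<in> G" if uv: "u \<in> G" "v \<in> G" for u v
      proof -
        obtain s t where "s \<ge> 0" "t \<ge> 0" "u = (s *\<^sub>R y, s * p y)" "v = (t *\<^sub>R y, t * p y)"
          using uv by (auto simp: G_def)
        then show ?thesis
          unfolding G_def by (intro image_eqI[of _ _ "s + t"]) (auto simp: algebra_simps)
      qed
      show "c *\<^sub>R u \<in> G" if cu: "c > 0" "u \<in> G" for c u
      proof -
        obtain t where "t \<ge> 0" "u = (t *\<^sub>R y, t * p y)"
          using cu(2) by (auto simp: G_def)
        then show ?thesis
          unfolding G_def using cu(1) by (intro image_eqI[of _ _ "c * t"]) auto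
      qed
      show "r \<le> p g" if "(g, r) \<in> G" for g r
        using that by (auto simp: G_def sublinear_scaleR[OF p])
    qed blast
    have "(y, p y) \<in> G"
      unfolding G_def by (intro image_eqI[of _ _ 1]) auto
    then have "p (- y) \<le> - p y"
      using q(3) minimal[OF q(1,2)] by blast
    then show ?thesis
      using sublinear_diff[OF p, of 0 y] sublinear_zero[OF p] sublinear_add[OF p, of y "- y"]
      by simp
  qed
  show ?thesis
  proof (rule linearI)
    show "p (x + y) = p x + p y" for x y
      using sublinear_add[OF p, of x y] sublinear_diff[OF p, of x y] neg[of y] by simp
    show "p (c *\<^sub>R x) = c *\<^sub>R p x" for c x
    proof (cases "c \<ge> 0")
      case True
      then show ?thesis by (simp add: sublinear_scaleR[OF p])
    next
      case False
      then have "p ((- c) *\<^sub>R x) = - c * p x"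
        by (intro sublinear_scaleR[OF p]) simp
      then show ?thesis using neg[of "c *\<^sub>R x"] by simp
    qed
  qed
qed

text \<open>Supplies the bounds for Zorn's lemma. The pointwise infimum is finite because every
  member lies below \<open>p\<close> and hence above \<open>- p (- x)\<close>. Subadditivity
  involves two members \<open>q\<close> and \<open>r\<close>; the smaller of them can replace
  both.\<close>

lemma sublinear_INF_chain:
  fixes F :: "('a::real_vector \<Rightarrow> real) set"
  assumes ne: "F \<noteq> {}"
    and sub: "\<And>q. q \<in> F \<Longrightarrow> sublinear q"
    and le: "\<And>q. q \<in> F \<Longrightarrow> q \<le> p"
    and chain: "\<And>q r. q \<in> F \<Longrightarrow> r \<in> F \<Longrightarrow> q \<le> r \<or> r \<le> q"
  obtains u where "sublinear u" "\<And>q. q \<in> F \<Longrightarrow> u \<le> q"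
proof -
  define u where "u = (\<lambda>x. INF q\<in>F. q x)"
  have lower: "- p (- x) \<le> q x" if "q \<in> F" for q x
    using sublinear_diff[OF sub[OF that], of 0 x] sublinear_zero[OF sub[OF that]]
      le_funD[OF le[OF that], of "- x"] by simp
  have u_le: "u x \<le> q x" if "q \<in> F" for q x
    unfolding u_def using lower that by (intro cINF_lower bdd_belowI2[of _ "- p (- x)"])
  have u_ge: "a \<le> u x" if "\<And>q. q \<in> F \<Longrightarrow> a \<le> q x" for a x
    unfolding u_def using ne that by (intro cINF_greatest) auto
  have "sublinear u"
  proof (rule sublinearI)
    fix x y
    have *: "u (x + y) \<le> q x + r y" if "q \<in> F" "r \<in> F" for q r
      using chain[OF that]
    proof
      assume "q \<le> r"
      then show ?thesis
        using u_le[OF that(1), of "x + y"] sublinear_add[OF sub[OF that(1)], of x y]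
          le_funD[of q r y] by linarith
    next
      assume "r \<le> q"
      then show ?thesis
        using u_le[OF that(2), of "x + y"] sublinear_add[OF sub[OF that(2)], of x y]
          le_funD[of r q x] by linarith
    qed
    have "u (x + y) - q x \<le> u y" if "q \<in> F" for q
      using *[OF that] by (intro u_ge) (simp add: algebra_simps)
    then have "u (x + y) - u y \<le> u x"
      by (intro u_ge) (simp add: algebra_simps)
    then show "u (x + y) \<le> u x + u y" by simp
  next
    obtain q where "q \<in> F" using ne by blast
    then have "u 0 \<le> 0"
      using u_le[of q 0] sublinear_zero[OF sub[of q]] by simp
    moreover have "0 \<le> u 0"
      by (intro u_ge) (simp add: sublinear_zero sub)
    ultimately show "u 0 = 0" by simp
  next
    fix c :: real and x
    assume c: "c > 0"
    have "u (c *\<^sub>R x) / c \<le> u x"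
    proof (rule u_ge)
      fix q assume "q \<in> F"
      then show "u (c *\<^sub>R x) / c \<le> q x"
        using u_le[of q "c *\<^sub>R x"] sublinear_scaleR[OF sub[of q], of c x] c
        by (simp add: field_simps)
    qed
    then show "u (c *\<^sub>R x) \<le> c * u x"
      using c by (simp add: field_simps)
  qed
  then show thesis
    using that u_le by (simp add: le_fun_def)
qed

lemma linear_below_sublinear:
  fixes p :: "'a::real_vector \<Rightarrow> real"
  assumes p: "sublinear p"
  obtains f where "linear f" "f \<le> p"
proof -
  define S where "S = {q. sublinear q \<and> q \<le> p}"
  have "\<exists>m\<in>S. \<forall>q\<in>S. q \<le> m \<longrightarrow> q = m"
  \<comment> \<open>The order is reversed, so that the maximal element is a minimal sublinear
    functional below \<open>p\<close>. The empty chain is bounded by \<open>p\<close>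
    itself.\<close>
  proof (rule predicate_Zorn)
    show "partial_order_on S (relation_of (\<lambda>q r. r \<le> q) S)"
      by (rule partial_order_on_relation_ofI) auto
    show "\<exists>u\<in>S. \<forall>q\<in>F. u \<le> q" if "F \<in> Chains (relation_of (\<lambda>q r. r \<le> q) S)" for F
    proof (cases "F = {}")
      case True
      then show ?thesis using p by (auto simp: S_def)
    next
      case False
      have F: "F \<subseteq> S" "\<And>q r. q \<in> F \<Longrightarrow> r \<in> F \<Longrightarrow> q \<le> r \<or> r \<le> q"
        using that by (auto simp: Chains_def relation_of_def)
      obtain u where u: "sublinear u" "\<And>q. q \<in> F \<Longrightarrow> u \<le> q"
        using sublinear_INF_chain[of F p] False F by (auto simp: S_def)
      then have "u \<in> S"
        using False F(1) by (force simp: S_def)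
      then show ?thesis using u(2) by blast
    qed
  qed
  then obtain m where m: "m \<in> S" "\<And>q. q \<in> S \<Longrightarrow> q \<le> m \<Longrightarrow> q = m"
    by blast
  then have "linear m"
    by (intro minimal_sublinear_linear) (auto simp: S_def)
  then show thesis
    using that m(1) by (auto simp: S_def)
qed

section \<open>Separation by continuous functionals\<close>

text \<open>The norm is lowered to a sublinear \<open>p\<close> with
  \<open>p (- s) \<le> - \<delta>\<close> on \<open>S\<close>. A linear \<open>f\<close> below
  \<open>p\<close> then has \<open>f s = - f (- s) \<ge> \<delta>\<close>, and it is bounded because
  \<open>p\<close> stays below the norm.\<close>

lemma convex_separation_from_zero:
  fixes S :: "'a::real_normed_vector set"
  assumes S: "convex S" "0 \<notin> closure S"
  obtains f :: "'a \<Rightarrow>\<^sub>L real" and \<delta> where "\<delta> > 0" "\<And>x. x \<in> S \<Longrightarrow> \<delta> \<le> f x"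
proof -
  obtain \<delta> where \<delta>: "\<delta> > 0" "\<And>x. x \<in> S \<Longrightarrow> \<delta> \<le> norm x"
    using S(2) by (auto simp: closure_approachable not_less)
  define G where "G = insert 0 {(t *\<^sub>R s, t * \<delta>) | t s. t > 0 \<and> s \<in> S}"
  obtain p where p: "sublinear p" "p \<le> norm" "\<And>g r. (g, r) \<in> G \<Longrightarrow> p (- g) \<le> - r"
  proof (rule sublinear_improve[OF sublinear_norm, of G])
    show "0 \<in> G" by (simp add: G_def)
    show "u + v \<in> G" if uv: "u \<in> G" "v \<in> G" for u v
    proof (cases "u = 0 \<or> v = 0")
      case True
      then show ?thesis using uv by auto
    next
      case False
      then obtain a x b y where
        uv: "u = (a *\<^sub>R x, a * \<delta>)" "v = (b *\<^sub>R y, b * \<delta>)" "a > 0" "b > 0" "x \<in> S" "y \<in> S"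
        using uv by (auto simp: G_def)
      \<comment> \<open>Convexity of \<open>S\<close> enters here: the sum of two points of
        \<open>G\<close> is a positive multiple of \<open>(z, \<delta>)\<close>.\<close>
      define z where "z = (a / (a + b)) *\<^sub>R x + (b / (a + b)) *\<^sub>R y"
      have "z \<in> S"
        unfolding z_def using uv S(1) by (intro convexD) (auto simp: add_divide_distrib[symmetric])
      moreover have "a + b > 0"
        using uv by simp
      moreover from this have "u + v = ((a + b) *\<^sub>R z, (a + b) * \<delta>)"
        using uv by (simp add: z_def scaleR_add_right distrib_right[of _ _ \<delta>])
      ultimately show ?thesis
        unfolding G_def by blast
    qed
    show "c *\<^sub>R u \<in> G" if cu: "c > 0" "u \<in> G" for c u
    proof (cases "u = 0")
      case False
      then obtain a x where u: "u = (a *\<^sub>R x, a * \<delta>)" "a > 0" "x \<in> S"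
        using cu by (auto simp: G_def)
      have "c *\<^sub>R u = ((c * a) *\<^sub>R x, (c * a) * \<delta>)" "c * a > 0"
        using u cu by auto
      then show ?thesis using u(3) unfolding G_def by blast
    qed (simp add: G_def)
    show "r \<le> norm g" if "(g, r) \<in> G" for g r
      using that \<delta> by (auto simp: G_def zero_prod_def)
  qed blast
  obtain f where f: "linear f" "f \<le> p"
    using linear_below_sublinear[OF p(1)] .
  have f_norm: "f x \<le> norm x" for x
    using le_funD[OF f(2), of x] le_funD[OF p(2), of x] by simp
  have "bounded_linear f"
  proof (rule bounded_linear_intro[of _ 1])
    show "f (x + y) = f x + f y" "f (c *\<^sub>R x) = c *\<^sub>R f x" for x y c
      using f(1) by (auto simp: linear_add linear_scale)
    show "norm (f x) \<le> norm x * 1" for x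
      using f_norm[of x] f_norm[of "- x"] linear_neg[OF f(1), of x] by auto
  qed
  moreover have "\<delta> \<le> f x" if "x \<in> S" for x
  proof -
    have "(x, \<delta>) \<in> G"
      unfolding G_def using that by (auto intro!: exI[of _ 1])
    then show ?thesis
      using p(3)[of x \<delta>] le_funD[OF f(2), of "- x"] linear_neg[OF f(1), of x] by simp
  qed
  ultimately show thesis
    using that[of \<delta> "Blinfun f"] \<delta>(1) by (simp add: bounded_linear_Blinfun_apply)
qed

text \<open>With \<open>m\<close> the infimum of \<open>f\<close> on \<open>cone_wedge C\<close>,
  the values on \<open>cone_vee K\<close> are at most \<open>m - \<delta>\<close>, so the level
  \<open>m - \<delta> / 2\<close> is strict on both sides. It is positive because
  \<open>cone_vee K\<close> contains the origin, whence \<open>m \<ge> \<delta>\<close>.\<close>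

lemma strict_separation_functional:
  fixes C K :: "'a::real_normed_vector set"
  assumes ssp: "strict_separation_property C K" and ne: "C \<inter> sphere 0 1 \<noteq> {}"
  obtains f :: "'a \<Rightarrow>\<^sub>L real" and \<alpha> where "\<alpha> > 0"
    "\<And>x. x \<in> C \<inter> sphere 0 1 \<Longrightarrow> \<alpha> < f x" "\<And>x. x \<in> frontier K \<inter> sphere 0 1 \<Longrightarrow> f x < \<alpha>"
proof -
  obtain f :: "'a \<Rightarrow>\<^sub>L real" and \<delta> where \<delta>: "\<delta> > 0"
    and f: "\<And>x. x \<in> {c - k | c k. c \<in> cone_wedge C \<and> k \<in> cone_vee K} \<Longrightarrow> \<delta> \<le> f x"
  proof -
    let ?D = "{c - k | c k. c \<in> cone_wedge C \<and> k \<in> cone_vee K}"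
    have "convex (\<Union>c\<in>cone_wedge C. \<Union>k\<in>cone_vee K. {c - k})"
      by (intro convex_differences) (simp_all add: cone_wedge_def cone_vee_def)
    also have "(\<Union>c\<in>cone_wedge C. \<Union>k\<in>cone_vee K. {c - k}) = ?D"
      by auto
    finally have "convex ?D" .
    moreover have "0 \<notin> closure ?D"
      using ssp unfolding strict_separation_property_def .
    ultimately show thesis
      using that by (rule convex_separation_from_zero)
  qed
  have sep: "f k + \<delta> \<le> f c" if "c \<in> cone_wedge C" "k \<in> cone_vee K" for c k
  proof -
    have "\<delta> \<le> f (c - k)"
      using that by (intro f) blast
    then show ?thesis by (simp add: blinfun.diff_right)
  qed
  have wedge: "x \<in> cone_wedge C" if "x \<in> C \<inter> sphere 0 1" for x
    using that unfolding cone_wedge_def by (rule hull_inc)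
  have vee: "x \<in> cone_vee K" if "x = 0 \<or> x \<in> frontier K \<inter> sphere 0 1" for x
    using that unfolding cone_vee_def by (intro hull_inc) auto
  define m where "m = (INF c\<in>cone_wedge C. f c)"
  have bdd: "bdd_below (f ` cone_wedge C)"
    using sep[OF _ vee[of 0]] by (intro bdd_belowI2[of _ \<delta>]) simp
  have m_le: "m \<le> f x" if "x \<in> C \<inter> sphere 0 1" for x
    unfolding m_def using bdd wedge[OF that] by (rule cINF_lower)
  have m_ge: "f k + \<delta> \<le> m" if "k \<in> cone_vee K" for k
    unfolding m_def
  proof (rule cINF_greatest)
    show "cone_wedge C \<noteq> {}"
      using ne wedge by blast
  qed (rule sep[OF _ that])
  show thesis
  proof (rule that[of "m - \<delta> / 2" f])
    show "m - \<delta> / 2 > 0"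
      using m_ge[OF vee[of 0]] \<delta> by simp
    show "m - \<delta> / 2 < f x" if "x \<in> C \<inter> sphere 0 1" for x
      using m_le[OF that] \<delta> by simp
    show "f x < m - \<delta> / 2" if "x \<in> frontier K \<inter> sphere 0 1" for x
      using m_ge[OF vee[of x]] that \<delta> by simp
  qed
qed

section \<open>Cones, their frontiers and Bishop-Phelps cones\<close>

text \<open>A positive dilation maps \<open>K\<close> onto itself; being bijective, it also
  preserves the complement, and therefore both closures whose intersection is the frontier.\<close>

lemma cone_frontier_scaleR:
  fixes K :: "'a::real_normed_vector set"
  assumes "cone K" "c > 0" "x \<in> frontier K"
  shows "c *\<^sub>R x \<in> frontier K"
proof -
  have img: "(*\<^sub>R) c ` K = K"
    using cone_iff[of K] assms by (cases "K = {}") auto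
  have "bij ((*\<^sub>R) c :: 'a \<Rightarrow> 'a)"
    using assms(2) by (intro o_bij[of "(*\<^sub>R) (1 / c)"]) auto
  then have "(*\<^sub>R) c ` (- K) = - K"
    using img by (simp add: bij_image_Compl_eq)
  then have "(*\<^sub>R) c ` closure (- K) = closure (- K)"
    by (simp add: closure_scaleR)
  moreover have "(*\<^sub>R) c ` closure K = closure K"
    using img by (simp add: closure_scaleR)
  ultimately have "c *\<^sub>R x \<in> closure K \<inter> closure (- K)"
    using assms(3) unfolding frontier_closures by blast
  then show ?thesis by (simp add: frontier_closures)
qed

text \<open>Deleting the origin does not destroy convexity, since \<open>f\<close> is strictly
  positive on the set and so on every convex combination.\<close>

lemma convex_Bishop_Phelps_cone:
  fixes f :: "'a::real_normed_vector \<Rightarrow>\<^sub>L real"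
  assumes "\<alpha> > 0"
  shows "convex {z. z \<noteq> 0 \<and> \<alpha> * norm z \<le> f z}"
proof (rule convexI)
  fix x y :: 'a and u v :: real
  assume xy: "x \<in> {z. z \<noteq> 0 \<and> \<alpha> * norm z \<le> f z}" "y \<in> {z. z \<noteq> 0 \<and> \<alpha> * norm z \<le> f z}"
    and uv: "0 \<le> u" "0 \<le> v" "u + v = 1"
  let ?z = "u *\<^sub>R x + v *\<^sub>R y"
  have "\<alpha> * norm ?z \<le> \<alpha> * (u * norm x + v * norm y)"
    using norm_triangle_ineq[of "u *\<^sub>R x" "v *\<^sub>R y"] uv assms by (intro mult_left_mono) auto
  also have "\<dots> = u * (\<alpha> * norm x) + v * (\<alpha> * norm y)"
    by (simp add: algebra_simps)
  also have "\<dots> \<le> u * f x + v * f y"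
    using xy uv by (intro add_mono mult_left_mono) auto
  also have "\<dots> = f ?z"
    by (simp add: blinfun.add_right blinfun.scaleR_right)
  finally have "\<alpha> * norm ?z \<le> f ?z" .
  moreover have "f ?z > 0"
  proof -
    have pos: "f x > 0" "f y > 0"
      using xy assms by (auto intro: less_le_trans[rotated])
    show ?thesis
    proof (cases "u = 0")
      case True
      then show ?thesis using pos uv by simp
    next
      case False
      then have "u * f x > 0" "v * f y \<ge> 0" using pos uv by auto
      then show ?thesis by (simp add: blinfun.add_right blinfun.scaleR_right)
    qed
  qed
  then have "?z \<noteq> 0" by auto
  ultimately show "?z \<in> {z. z \<noteq> 0 \<and> \<alpha> * norm z \<le> f z}" by simp
qed

text \<open>A connected set that meets \<open>K\<close> but not its frontier lies in
  \<open>K\<close>. Homogeneity carries the bound on \<open>f\<close> from the unit sphere to every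
  nonzero frontier point.\<close>

lemma Bishop_Phelps_cone_subset:
  fixes f :: "'a::real_normed_vector \<Rightarrow>\<^sub>L real"
  assumes K: "cone K" and \<alpha>: "\<alpha> > 0"
    and frontier: "\<And>x. x \<in> frontier K \<inter> sphere 0 1 \<Longrightarrow> f x < \<alpha>"
    and meets: "c \<in> K" "c \<noteq> 0" "\<alpha> * norm c \<le> f c"
  shows "{z. z \<noteq> 0 \<and> \<alpha> * norm z \<le> f z} \<subseteq> K" (is "?D \<subseteq> K")
proof -
  have "?D \<inter> frontier K = {}"
  proof -
    have "f z < \<alpha> * norm z" if z: "z \<noteq> 0" "z \<in> frontier K" for z
    proof -
      have "f ((1 / norm z) *\<^sub>R z) < \<alpha>"
        using z cone_frontier_scaleR[OF K, of "1 / norm z" z] by (intro frontier) auto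
      then show ?thesis
        using z by (simp add: blinfun.scaleR_right field_simps)
    qed
    then show ?thesis by fastforce
  qed
  moreover have "?D \<inter> K \<noteq> {}"
    using meets by blast
  ultimately show ?thesis
    using connected_Int_frontier[OF convex_connected[OF convex_Bishop_Phelps_cone[OF \<alpha>, of f]], of K]
    by blast
qed

theorem theorem3p6:
  fixes C Q A :: "'a::real_normed_vector set" and x0 :: 'a
  assumes "ordering_cone C"
    and "open_cone Q"
    and "x0 \<in> A"
    and "minimal_point Q A x0"
    and "C \<inter> Q \<noteq> {}"
    and "strict_separation_property C (insert 0 Q)"
  shows "\<exists>(f, \<alpha>) \<in> augmented_dual_sharp C.
    {x. is_arg_min (\<lambda>x. blinfun_apply f (x - x0) + \<alpha> * norm (x - x0)) (\<lambda>x. x \<in> A) x} = {x0}"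
proof -
  have C: "cone C" and K: "cone (insert 0 Q)" and "open Q" and K_proper: "insert 0 Q \<noteq> UNIV"
    using assms(1,2) by (auto simp: ordering_cone_def open_cone_def nontrivial_cone_def)
  have unit: "(1 / norm x) *\<^sub>R x \<in> C \<inter> sphere 0 1" if "x \<in> C" "x \<noteq> 0" for x
    using that C by (auto simp: cone_def)
  \<comment> \<open>Otherwise \<open>Q\<close> contains a ball around the origin, and scaling that
    ball would fill the whole space.\<close>
  have "0 \<notin> Q"
  proof
    assume "0 \<in> Q"
    then obtain e where e: "e > 0" "ball 0 e \<subseteq> Q"
      using \<open>open Q\<close> open_contains_ball by blast
    have "x \<in> insert 0 Q" for x
    proof (cases "x = 0")
      case False
      have "(e / 2 / norm x) *\<^sub>R x \<in> Q"
        using False e(1) by (intro subsetD[OF e(2)]) simp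
      then have "(norm x * 2 / e) *\<^sub>R ((e / 2 / norm x) *\<^sub>R x) \<in> insert 0 Q"
        using e(1) by (intro mem_cone[OF K insertI2]) auto
      then show ?thesis using False e(1) by simp
    qed simp
    then show False using K_proper by blast
  qed
  \<comment> \<open>The common point is nonzero, so it can be normalized and serves as the point
    where the Bishop-Phelps cone meets \<open>Q\<close>.\<close>
  obtain c where c: "c \<in> C" "c \<in> Q" "c \<noteq> 0"
    using assms(5) \<open>0 \<notin> Q\<close> by blast
  have "C \<inter> sphere 0 1 \<noteq> {}"
    using unit[OF c(1,3)] by blast
  then obtain f :: "'a \<Rightarrow>\<^sub>L real" and \<alpha> where \<alpha>: "\<alpha> > 0"
    and fC: "\<And>x. x \<in> C \<inter> sphere 0 1 \<Longrightarrow> \<alpha> < f x"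
    and fK: "\<And>x. x \<in> frontier (insert 0 Q) \<inter> sphere 0 1 \<Longrightarrow> f x < \<alpha>"
    using strict_separation_functional[OF assms(6)] by metis
  have fC': "\<alpha> * norm x < f x" if "x \<in> C" "x \<noteq> 0" for x
    using fC[OF unit[OF that]] that by (simp add: blinfun.scaleR_right field_simps)
  have "0 < f x" if "x \<in> C" "x \<noteq> 0" for x
    using fC'[OF that] \<alpha> by (intro le_less_trans[of 0 "\<alpha> * norm x"]) auto
  then have aug: "(f, \<alpha>) \<in> augmented_dual_sharp C"
    using fC' \<alpha> by (simp add: augmented_dual_sharp_def dual_sharp_def)
  have sub: "{z. z \<noteq> 0 \<and> \<alpha> * norm z \<le> f z} \<subseteq> insert 0 Q"
    using c fC'[of c] by (intro Bishop_Phelps_cone_subset[OF K \<alpha> fK, of c]) auto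
  have pos: "0 < f (x - x0) + \<alpha> * norm (x - x0)" if x: "x \<in> A" "x \<noteq> x0" for x
  proof (rule ccontr)
    assume "\<not> ?thesis"
    \<comment> \<open>A nonpositive value at \<open>x\<close> puts \<open>x0 - x\<close> into the
      Bishop-Phelps cone, hence into \<open>Q\<close>, against minimality.\<close>
    then have "\<alpha> * norm (x0 - x) \<le> f (x0 - x)"
      by (simp add: norm_minus_commute blinfun.diff_right)
    then have "x0 - x \<in> insert 0 Q"
      using x(2) by (intro subsetD[OF sub]) simp
    then have "x0 - x \<in> Q"
      using x(2) by simp
    then have "x - x0 \<in> uminus ` Q"
      by (intro image_eqI[of _ _ "x0 - x"]) auto
    then show False
      using assms(4) x(1) by (auto simp: minimal_point_def)
  qed
  have "is_arg_min (\<lambda>x. f (x - x0) + \<alpha> * norm (x - x0)) (\<lambda>x. x \<in> A) x \<longleftrightarrow> x = x0" for x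
  proof
    assume "is_arg_min (\<lambda>x. f (x - x0) + \<alpha> * norm (x - x0)) (\<lambda>x. x \<in> A) x"
    \<comment> \<open>Comparison with \<open>x0\<close>, where the objective is 0.\<close>
    then have "x \<in> A" "\<not> 0 < f (x - x0) + \<alpha> * norm (x - x0)"
      using assms(3) by (auto simp: is_arg_min_def)
    then show "x = x0" using pos by blast
  next
    assume "x = x0"
    then show "is_arg_min (\<lambda>x. f (x - x0) + \<alpha> * norm (x - x0)) (\<lambda>x. x \<in> A) x"
      using assms(3) pos by (force simp: is_arg_min_def)
  qed
  then show ?thesis using aug by blast
qed

end
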